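(* Let $r\ge 4$, let $d,m_1,\dots,m_r$ be non-negative integers, and let $\mathcal{L}=\mathcal{L}_3(d,m_1,\dots,m_r)$. Suppose that $2d\ge m_i+m_j+m_k$ for every choice of three distinct indices $\{i,j,k\}\subset\{1,2,3,4\}$. If the degree of $\mathrm{Cr}(\mathcal{L})$ is smaller than the degree of $\mathcal{L}$, then $v(\mathrm{Cr}(\mathcal{L}))\ge v(\mathcal{L})$.
   Context: $\mathcal{L}_3(d,m_1,\dots,m_r)$ denotes the linear system of degree $d$ surfaces of $\mathbb{P}^3$ (over $\mathbb{C}$) having multiplicity at least $m_i$ at $p_i$, for given points $p_1,\dots,p_r$. Its virtual dimension is $$v(\mathcal{L}_3(d,m_1,\dots,m_r))=\binom{d+3}{3}-\sum_{i=1}^r\binom{m_i+2}{3}-1.$$ The cubic Cremona transformation based at $p_1,\dots,p_4$ (taken as the coordinate points), $(x_1:x_2:x_3:x_4)\dashrightarrow(x_1^{-1}:x_2^{-1}:x_3^{-1}:x_4^{-1})$, transforms $\mathcal{L}=\mathcal{L}_3(d,m_1,\dots,m_r)$ into $$\mathrm{Cr}(\mathcal{L})=\mathcal{L}_3(d+k,m_1+k,\dots,m_4+k,m_5,\dots,m_r),\qquad k=2d-\sum_{i=1}^4m_i.$$ *)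

theory Defs
  imports Complex_Main
begin

text \<open>
  The system \<open>L3 d r m\<close> stands for the linear system of degree \<open>d\<close> surfaces of complex projective
  3-space having multiplicity at least \<open>m i\<close> at \<open>p\<^sub>i\<close>, for \<open>1 \<le> i \<le> r\<close>. A system is
  kept as a symbol, not as a set of surfaces: its degree, its virtual dimension and the effect of the
  Cremona transformation are functions of \<open>d, m\<^sub>1, \<dots>, m\<^sub>r\<close>, and they are not determined
  by the set of surfaces (which may be empty, or have larger multiplicities than the assigned ones).
  The entries are integers because \<open>k\<close> below may be negative. Values of \<open>m\<close> outside
  \<open>{1..r}\<close> are irrelevant.
\<close>

datatype linear_system =
  L3 (sys_degree: int) (sys_points: nat) (sys_mult: "nat \<Rightarrow> int")

text \<open>
  The truncation by \<open>nat\<close> only makes \<open>0\<close> the value of a binomial with negative upper entry: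
  there are no forms of negative degree, and a negative multiplicity imposes no conditions.
\<close>

definition virtual_dim :: "linear_system \<Rightarrow> int" where
  "virtual_dim L =
     int (nat (sys_degree L + 3) choose 3)
     - (\<Sum>i = 1..sys_points L. int (nat (sys_mult L i + 2) choose 3)) - 1"

text \<open>
  The action of \<open>(x\<^sub>1 : x\<^sub>2 : x\<^sub>3 : x\<^sub>4) \<mapsto> (1/x\<^sub>1 : 1/x\<^sub>2 : 1/x\<^sub>3 : 1/x\<^sub>4)\<close>,
  where \<open>p\<^sub>1, \<dots>, p\<^sub>4\<close> are the coordinate points; meaningful for at least four points.
\<close>

definition cremona_shift :: "linear_system \<Rightarrow> int" where
  "cremona_shift L = 2 * sys_degree L - (\<Sum>i = 1..4. sys_mult L i)"

definition Cr :: "linear_system \<Rightarrow> linear_system" where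
  "Cr L = L3 (sys_degree L + cremona_shift L) (sys_points L)
     (\<lambda>i. if i \<in> {1..4} then sys_mult L i + cremona_shift L else sys_mult L i)"

end

theory Submission
  imports Defs
begin

text \<open>
  Put \<open>t\<^sub>i\<^sub>j = m\<^sub>i + m\<^sub>j - d\<close>, the multiplicity with which the line through \<open>p\<^sub>i\<close> and \<open>p\<^sub>j\<close> is
  expected to occur in the base locus. The hypothesis makes all degrees and multiplicities of the
  transformed system non-negative, so all binomials are values of the corresponding polynomials, and
  as polynomials \<open>v(Cr L) - v(L)\<close> is the sum of \<open>(t\<^sub>i\<^sub>j + 1 choose 3) = (t\<^sub>i\<^sub>j\<^sup>3 - t\<^sub>i\<^sub>j) / 6\<close> over the six
  lines. Opposite lines satisfy \<open>t\<^sub>i\<^sub>j + t\<^sub>k\<^sub>l = -k > 0\<close>, and \<open>t\<^sup>3 - t\<close> is odd and monotone on the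
  integers, so each of the three opposite pairs contributes a non-negative amount.
\<close>

lemma choose_three_int:
  fixes n :: int
  assumes "n \<ge> 0"
  shows "6 * int (nat n choose 3) = n * (n - 1) * (n - 2)"
proof -
  have "6 * int (k choose 3) = int k * (int k - 1) * (int k - 2)" for k
  proof (induction k)
    case (Suc k)
    have two: "2 * int (k choose 2) = int k * (int k - 1)"
      by (induction k) (simp_all add: numeral_2_eq_2 algebra_simps)
    have "Suc k choose 3 = (k choose 2) + (k choose 3)"
      by (simp add: numeral_3_eq_3 numeral_2_eq_2)
    with Suc two show ?case
      by (simp add: algebra_simps)
  qed simp
  from this[of "nat n"] assms show ?thesis
    by simp
qed

text \<open>The sum has the factor \<open>a + b\<close>; the cofactor is
  \<open>a\<^sup>2 - a * b + b\<^sup>2 - 1\<close>, where the quadratic form is a positive integer,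
  hence at least 1.\<close>

lemma cube_minus_self_pair_nonneg:
  fixes a b :: int
  assumes "a + b > 0"
  shows "(a ^ 3 - a) + (b ^ 3 - b) \<ge> 0"
proof -
  have "0 < (a + b)\<^sup>2 + 3 * (a - b)\<^sup>2"
    using assms by (simp add: add_pos_nonneg)
  also have "\<dots> = 4 * (a\<^sup>2 - a * b + b\<^sup>2)"
    by (simp add: power2_eq_square algebra_simps)
  finally have "0 \<le> a\<^sup>2 - a * b + b\<^sup>2 - 1"
    by simp
  with assms have "0 \<le> (a + b) * (a\<^sup>2 - a * b + b\<^sup>2 - 1)"
    by simp
  also have "\<dots> = (a ^ 3 - a) + (b ^ 3 - b)"
    by (simp add: power2_eq_square power3_eq_cube algebra_simps)
  finally show ?thesis .
qed

lemma sum_first_four: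
  fixes f :: "nat \<Rightarrow> int"
  assumes "r \<ge> 4"
  shows "(\<Sum>i = 1..r. f i) = f 1 + f 2 + f 3 + f 4 + (\<Sum>i = 5..r. f i)"
proof -
  have "{1..r} = {1, 2, 3, 4} \<union> {5..r}"
    using assms by auto
  then show ?thesis
    by (simp add: sum.union_disjoint)
qed

theorem corollary2p4:
  fixes r d :: nat and m :: "nat \<Rightarrow> nat" and L :: linear_system
  assumes "r \<ge> 4"
    and "L = L3 (int d) r (\<lambda>i. int (m i))"
    and "\<And>i j k. \<lbrakk>i \<in> {1..4}; j \<in> {1..4}; k \<in> {1..4}; i \<noteq> j; j \<noteq> k; i \<noteq> k\<rbrakk>
           \<Longrightarrow> 2 * d \<ge> m i + m j + m k"
    and "sys_degree (Cr L) < sys_degree L"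
  shows "virtual_dim (Cr L) \<ge> virtual_dim L"
proof -
  define D a b c e where "D = int d" and "a = int (m 1)" and "b = int (m 2)"
    and "c = int (m 3)" and "e = int (m 4)"
  note coords = D_def a_def b_def c_def e_def
  define k where "k = 2 * D - (a + b + c + e)"
  have shift: "cremona_shift L = k"
    using sum_first_four[of 4 "\<lambda>i. int (m i)"]
    by (simp add: cremona_shift_def assms(2) k_def coords)
  have nonneg: "D \<ge> 0" "a \<ge> 0" "b \<ge> 0" "c \<ge> 0" "e \<ge> 0"
    by (simp_all add: coords)
  have "k < 0"
    using assms(4) by (simp add: Cr_def shift)
  \<comment> \<open>Each value is \<open>2 * D\<close> minus the other three multiplicities.\<close>
  have nonneg': "a + k \<ge> 0" "b + k \<ge> 0" "c + k \<ge> 0" "e + k \<ge> 0"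
    using assms(3)[of 2 3 4] assms(3)[of 1 3 4] assms(3)[of 1 2 4] assms(3)[of 1 2 3]
    by (simp_all add: k_def coords)
  \<comment> \<open>Adding the four bounds gives
    \<open>3 * (a + b + c + e) \<le> 8 * D \<le> 9 * D\<close>.\<close>
  then have "D + k \<ge> 0"
    using nonneg by (simp add: k_def)
  define B where "B n = int (nat n choose 3)" for n
  have B: "6 * B n = n * (n - 1) * (n - 2)" if "n \<ge> 0" for n
    using choose_three_int[OF that] by (simp add: B_def)
  \<comment> \<open>The terms of the points from the fifth on cancel.\<close>
  have "virtual_dim (Cr L) - virtual_dim L =
      B (D + k + 3) - B (a + k + 2) - B (b + k + 2) - B (c + k + 2) - B (e + k + 2)
      - (B (D + 3) - B (a + 2) - B (b + 2) - B (c + 2) - B (e + 2))"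
    unfolding virtual_dim_def Cr_def shift B_def
    using assms(1) by (simp add: assms(2) sum_first_four coords del: One_nat_def)
  then have "6 * (virtual_dim (Cr L) - virtual_dim L) =
      6 * B (D + k + 3) - 6 * B (a + k + 2) - 6 * B (b + k + 2) - 6 * B (c + k + 2)
      - 6 * B (e + k + 2)
      - (6 * B (D + 3) - 6 * B (a + 2) - 6 * B (b + 2) - 6 * B (c + 2) - 6 * B (e + 2))"
    by simp
  also have "\<dots> =
      (((a + b - D) ^ 3 - (a + b - D)) + ((c + e - D) ^ 3 - (c + e - D)))
      + (((a + c - D) ^ 3 - (a + c - D)) + ((b + e - D) ^ 3 - (b + e - D)))
      + (((a + e - D) ^ 3 - (a + e - D)) + ((b + c - D) ^ 3 - (b + c - D)))"
    using nonneg nonneg' \<open>D + k \<ge> 0\<close>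
    by (simp add: B) (simp add: k_def power3_eq_cube algebra_simps)
  also have "\<dots> \<ge> 0"
    using \<open>k < 0\<close> by (intro add_nonneg_nonneg[OF add_nonneg_nonneg] cube_minus_self_pair_nonneg)
      (simp_all add: k_def)
  finally show ?thesis
    by simp
qed

end
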